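(* Let ${\bf M}=(\mathcal L,l_0,l_f,\Gamma,b,k,L,(X_i)_{0\le i\le L},{\rm Stm}_M)$ and ${\bf N}=(\mathcal L,l_0,l_f,\Gamma,b,k,L,(Y_i)_{0\le i\le L},{\rm Stm}_N)$ be generalized Turing machines (with the same $\mathcal L,l_0,l_f,\Gamma,b,k,L$) and let $\gamma_i:X_i\rightrightarrows Y_i$ ($0\le i\le L$) be generalized multi-representations. If ${\bf M}$ realizes ${\bf N}$ via $(\gamma_i)_{i=0}^L$, then the multi-function $f_M:X_1\times\cdots\times X_k\rightrightarrows X_0$ computed by ${\bf M}$ realizes the multi-function $f_N:Y_1\times\cdots\times Y_k\rightrightarrows Y_0$ computed by ${\bf N}$ via $(\gamma_1,\ldots,\gamma_k,\gamma_0)$.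
   Context: **Multi-functions.** A multi-function $f:A\rightrightarrows B$ is a triple $(A,B,R_f)$ with $R_f\subseteq A\times B$; $f(a):=\{b\mid (a,b)\in R_f\}$, $\mathrm{dom}(f):=\{a\mid f(a)\ne\emptyset\}$, $\mathrm{range}(f):=\bigcup_{a\in A} f(a)$. If every $f(a)$ has at most one element, $f$ is a partial function, written $f:\subseteq A\to B$. A generalized multi-representation is a multi-function $\gamma:X\rightrightarrows Y$ with $\mathrm{range}(\gamma)=Y$. **Realization of multi-functions.** Let $f:X_1\times\cdots\times X_n\rightrightarrows X_0$, $g:Y_1\times\cdots\times Y_n\rightrightarrows Y_0$ and let $\gamma_i:X_i\rightrightarrows Y_i$ ($0\le i\le n$) be generalized multi-representations. Put $\gamma(x):=\gamma_1(x_1)\times\cdots\times\gamma_n(x_n)$. Then $f$ realizes $g$ via $(\gamma_1,\ldots,\gamma_n,\gamma_0)$ (is a $(\gamma_1,\ldots,\gamma_n,\gamma_0)$-realization of $g$) iff for all $x,y$: if $y\in\gamma(x)\cap\mathrm{dom}(g)$ then $f(x)\ne\emptyset$ and for all $x_0\in f(x)$, $g(y)\cap\gamma_0(x_0)\ne\emptyset$. **Generalized Turing machine (GTM).** $\Sigma$ is a fixed finite alphabet with $0,1\in\Sigma$; $\Sigma^*$ is the set of finite words; $\mathrm{id}_*$ is the identity on $\Sigma^*$. A GTM is a tuple $(\mathcal L,l_0,l_f,\Gamma,b,k,L,(X_i)_{0\le i\le L},{\rm Stm})$ where $\mathcal L$ is a finite set (labels) with $l_0,l_f\in\mathcal L$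 (initial, final label); $\Gamma$ is a finite set with $\Sigma\cap\Gamma=\emptyset$ and $b\in\Gamma$ (blank); $k,L\in\mathbb N$, $k\le L$ (tapes $0,\ldots,L$; input tapes $1,\ldots,k$; output tape $0$); each $X_i$ is a set with $X_i\cap\Gamma=\emptyset$; and ${\rm Stm}$ assigns to each $l\in\mathcal L\setminus\{l_f\}$ a statement of one of the forms (with $i,i_1,\ldots,i_n\in\{0,\ldots,L\}$, $l',l''\in\mathcal L$, $a\in\Gamma$): (a) $(i,{\rm right},l')$; (b) $(i,{\rm left},l')$; (c) $(i:=a,l')$; (d) $(i,{\rm if}\ a\ {\rm then}\ l',\ {\rm else}\ l'')$; (e) $(i:=f(i_1,\ldots,i_n),l')$ with $f:X_{i_1}\times\cdots\times X_{i_n}\rightrightarrows X_i$; (f) $({\rm if}\ f(i_1,\ldots,i_n)\ {\rm then}\ l',\ {\rm else}\ l'')$ with $f:\subseteq X_{i_1}\times\cdots\times X_{i_n}\to\Sigma^*$, $\mathrm{range}(f)\subseteq\{0,1\}$. **Semantics.** A configuration is $\kappa=(l,(\alpha_0,m_0),\ldots,(\alpha_L,m_L))$ with $l\in\mathcal L$, $\alpha_i:\mathbb Z\to X_i\cup\Gamma$ (tape inscription), $m_i\in\mathbb Z$ (head position). Let $x_j:=\alpha_j(m_j)$. The successor relation $\kappa\vdash\kappa'$ is determined by ${\rm Stm}(l)$ (no successor if $l=l_f$): in case (a)/(b), $\kappa'$ is $\kappa$ with $m_i$ replaced by $m_i+1$ / $m_i-1$ and label $l'$; (c) $\kappa'$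 is $\kappa$ with $\alpha_i(m_i)$ replaced by $a$ and label $l'$; (d) $\kappa'$ is $\kappa$ with label $l'$ if $x_i=a$ and with label $l''$ if $x_i\ne a$; (e) $\kappa'$ is $\kappa$ with $\alpha_i(m_i)$ replaced by some $x\in f(x_{i_1},\ldots,x_{i_n})$ and label $l'$ (no successor if there is no such $x$, in particular if some $x_{i_j}\notin X_{i_j}$); (f) $\kappa'$ is $\kappa$ with label $l'$ if $f(x_{i_1},\ldots,x_{i_n})=0$ and label $l''$ if $f(x_{i_1},\ldots,x_{i_n})=1$ (no successor otherwise). A computation is a finite or infinite sequence of configurations, each the $\vdash$-predecessor of the next; it is maximal if it is infinite or its last configuration has no successor. A configuration is accepting if $l=l_f$ and $\alpha_0(0)\in X_0$; an accepting computation is a finite computation whose last configuration is accepting. The initial configuration ${\rm IC}(x_1,\ldots,x_k)$ has label $l_0$, all heads at position $0$, $\alpha_i(0)=x_i$ for $1\le i\le k$, and $b$ in all other cells. The multi-function $f_M:X_1\times\cdots\times X_k\rightrightarrows X_0$ computed by the machine is defined by: $x_0\in f_M(x_1,\ldots,x_k)$ iff every maximal computation starting with ${\rm IC}(x_1,\ldots,x_k)$ is accepting and there is an accepting computation starting with ${\rm IC}(x_1,\ldots,x_k)$ whose last configuration has $\alpha_0(0)=x_0$. **Realization of machines.** ${\bf M}$ realizes ${\bf N}$ via $(\gamma_i)_{i=0}^L$ iff for all labels $l\in\mathcal L\setminus\{l_f\}$: (1) if ${\rm Stm}_M(l)$ has form (a)–(d) then ${\rm Stm}_M(l)={\rm Stm}_N(l)$;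 (2) if ${\rm Stm}_M(l)=(i:=f(i_1,\ldots,i_n),l')$ then ${\rm Stm}_N(l)=(i:=g(i_1,\ldots,i_n),l')$ for some $g:Y_{i_1}\times\cdots\times Y_{i_n}\rightrightarrows Y_i$ such that $f$ is a $(\gamma_{i_1},\ldots,\gamma_{i_n},\gamma_i)$-realization of $g$; (3) if ${\rm Stm}_M(l)=({\rm if}\ f(i_1,\ldots,i_n)\ {\rm then}\ l',\ {\rm else}\ l'')$ then ${\rm Stm}_N(l)=({\rm if}\ g(i_1,\ldots,i_n)\ {\rm then}\ l',\ {\rm else}\ l'')$ for some $g:\subseteq Y_{i_1}\times\cdots\times Y_{i_n}\to\Sigma^*$ such that $f$ is a $(\gamma_{i_1},\ldots,\gamma_{i_n},\mathrm{id}_* )$-realization of $g$. *)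

theory Defs
  imports Main
begin

text \<open>
  A multi-function is encoded by its set-valued map; source and target are carried by the predicate
  \<open>multifun\<close>.  Tuples are lists and finite products are \<^const>\<open>listset\<close>, so that the arity may be any
  natural number (including 0).
\<close>

definition multifun :: "'a set \<Rightarrow> 'b set \<Rightarrow> ('a \<Rightarrow> 'b set) \<Rightarrow> bool" where
  "multifun A B f \<longleftrightarrow> {(a, b). b \<in> f a} \<subseteq> A \<times> B"

definition mdom :: "('a \<Rightarrow> 'b set) \<Rightarrow> 'a set" where
  "mdom f = {a. f a \<noteq> {}}"

definition mrange :: "('a \<Rightarrow> 'b set) \<Rightarrow> 'b set" where
  "mrange f = (\<Union>a. f a)"

definition partial_fun :: "'a set \<Rightarrow> 'b set \<Rightarrow> ('a \<Rightarrow> 'b set) \<Rightarrow> bool" where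
  "partial_fun A B f \<longleftrightarrow> multifun A B f \<and> (\<forall>a. \<forall>b\<in>f a. \<forall>b'\<in>f a. b = b')"

definition gen_multirep :: "'a set \<Rightarrow> 'b set \<Rightarrow> ('a \<Rightarrow> 'b set) \<Rightarrow> bool" where
  "gen_multirep X Y \<gamma> \<longleftrightarrow> multifun X Y \<gamma> \<and> mrange \<gamma> = Y"

text \<open>The length guard is needed because \<^const>\<open>zip\<close> truncates.\<close>

definition prod_rep :: "('a \<Rightarrow> 'b set) list \<Rightarrow> 'a list \<Rightarrow> 'b list set" where
  "prod_rep \<gamma>s xs =
    (if length xs = length \<gamma>s then listset (map (\<lambda>(\<gamma>, x). \<gamma> x) (zip \<gamma>s xs)) else {})"

text \<open>
  The quantifiers need not be relativised to the sources: a multi-representation is empty outside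
  its source, and \<open>mdom g\<close> is contained in the source of \<open>g\<close>.
\<close>

definition realizes ::
  "('a \<Rightarrow> 'b set) list \<Rightarrow> ('c \<Rightarrow> 'd set) \<Rightarrow> ('a list \<Rightarrow> 'c set) \<Rightarrow> ('b list \<Rightarrow> 'd set) \<Rightarrow> bool" where
  "realizes \<gamma>s \<gamma>0 f g \<longleftrightarrow>
    (\<forall>x y. y \<in> prod_rep \<gamma>s x \<inter> mdom g \<longrightarrow>
      f x \<noteq> {} \<and> (\<forall>x0\<in>f x. g y \<inter> \<gamma>0 x0 \<noteq> {}))"

definition id_words :: "'u set \<Rightarrow> 'u list \<Rightarrow> 'u list set" where
  "id_words \<Sigma> w = (if w \<in> lists \<Sigma> then {w} else {})"

definition alphabet :: "'u set \<Rightarrow> 'u \<Rightarrow> 'u \<Rightarrow> bool" where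
  "alphabet \<Sigma> zero one \<longleftrightarrow> finite \<Sigma> \<and> zero \<in> \<Sigma> \<and> one \<in> \<Sigma> \<and> zero \<noteq> one"


text \<open>
  All symbols and tape data live in one type \<open>'u\<close>; the sets \<open>\<Sigma>\<close>, \<open>\<Gamma>\<close>, \<open>X\<^sub>i\<close> are subsets of
  it, so that \<open>X\<^sub>i \<union> \<Gamma>\<close> is a plain union and the disjointness conditions are explicit.
\<close>

datatype ('l, 'u) stmt =
    MoveRight nat 'l
  | MoveLeft nat 'l
  | Write nat 'u 'l
  | IfSymbol nat 'u 'l 'l
  | Assign nat "'u list \<Rightarrow> 'u set" "nat list" 'l
  | Branch "'u list \<Rightarrow> 'u list set" "nat list" 'l 'l

record ('l, 'u) machine =
  labels :: "'l set"
  l_init :: 'l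
  l_final :: 'l
  gamma :: "'u set"
  blank :: 'u
  inputs :: nat
  last_tape :: nat
  data :: "nat \<Rightarrow> 'u set"
  stm :: "'l \<Rightarrow> ('l, 'u) stmt"

definition data_prod :: "('l, 'u) machine \<Rightarrow> nat list \<Rightarrow> 'u list set" where
  "data_prod M js = listset (map (data M) js)"

fun wf_stmt :: "'u set \<Rightarrow> 'u \<Rightarrow> 'u \<Rightarrow> ('l, 'u) machine \<Rightarrow> ('l, 'u) stmt \<Rightarrow> bool" where
  "wf_stmt \<Sigma> zero one M (MoveRight i l') \<longleftrightarrow> i \<le> last_tape M \<and> l' \<in> labels M"
| "wf_stmt \<Sigma> zero one M (MoveLeft i l') \<longleftrightarrow> i \<le> last_tape M \<and> l' \<in> labels M"
| "wf_stmt \<Sigma> zero one M (Write i a l') \<longleftrightarrow> i \<le> last_tape M \<and> a \<in> gamma M \<and> l' \<in> labels M"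
| "wf_stmt \<Sigma> zero one M (IfSymbol i a l' l'') \<longleftrightarrow>
    i \<le> last_tape M \<and> a \<in> gamma M \<and> l' \<in> labels M \<and> l'' \<in> labels M"
| "wf_stmt \<Sigma> zero one M (Assign i f js l') \<longleftrightarrow>
    i \<le> last_tape M \<and> set js \<subseteq> {..last_tape M} \<and> l' \<in> labels M \<and>
    multifun (data_prod M js) (data M i) f"
| "wf_stmt \<Sigma> zero one M (Branch f js l' l'') \<longleftrightarrow>
    set js \<subseteq> {..last_tape M} \<and> l' \<in> labels M \<and> l'' \<in> labels M \<and>
    partial_fun (data_prod M js) (lists \<Sigma>) f \<and> mrange f \<subseteq> {[zero], [one]}"

text \<open>The value of \<open>stm M\<close> at the final label and outside \<open>labels M\<close> is never used.\<close>

definition gtm :: "'u set \<Rightarrow> 'u \<Rightarrow> 'u \<Rightarrow> ('l, 'u) machine \<Rightarrow> bool" where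
  "gtm \<Sigma> zero one M \<longleftrightarrow>
    finite (labels M) \<and> l_init M \<in> labels M \<and> l_final M \<in> labels M \<and>
    finite (gamma M) \<and> \<Sigma> \<inter> gamma M = {} \<and> blank M \<in> gamma M \<and>
    inputs M \<le> last_tape M \<and>
    (\<forall>i\<le>last_tape M. data M i \<inter> gamma M = {}) \<and>
    (\<forall>l\<in>labels M - {l_final M}. wf_stmt \<Sigma> zero one M (stm M l))"


text \<open>
  Tapes are indexed by all of \<open>nat\<close>; those beyond \<open>last_tape\<close> are never read or changed.
\<close>

record ('l, 'u) config =
  lab :: 'l
  insc :: "nat \<Rightarrow> int \<Rightarrow> 'u"
  head :: "nat \<Rightarrow> int"

definition is_config :: "('l, 'u) machine \<Rightarrow> ('l, 'u) config \<Rightarrow> bool" where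
  "is_config M \<kappa> \<longleftrightarrow> lab \<kappa> \<in> labels M \<and>
    (\<forall>i\<le>last_tape M. \<forall>z. insc \<kappa> i z \<in> data M i \<union> gamma M)"

definition scan :: "('l, 'u) config \<Rightarrow> nat \<Rightarrow> 'u" where
  "scan \<kappa> i = insc \<kappa> i (head \<kappa> i)"

definition goto :: "'l \<Rightarrow> ('l, 'u) config \<Rightarrow> ('l, 'u) config" where
  "goto l \<kappa> = \<kappa>\<lparr>lab := l\<rparr>"

definition move :: "nat \<Rightarrow> int \<Rightarrow> ('l, 'u) config \<Rightarrow> ('l, 'u) config" where
  "move i d \<kappa> = \<kappa>\<lparr>head := (head \<kappa>)(i := head \<kappa> i + d)\<rparr>"

definition put :: "nat \<Rightarrow> 'u \<Rightarrow> ('l, 'u) config \<Rightarrow> ('l, 'u) config" where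
  "put i x \<kappa> = \<kappa>\<lparr>insc := (insc \<kappa>)(i := (insc \<kappa> i)(head \<kappa> i := x))\<rparr>"

fun exec :: "'u \<Rightarrow> 'u \<Rightarrow> ('l, 'u) stmt \<Rightarrow> ('l, 'u) config \<Rightarrow> ('l, 'u) config \<Rightarrow> bool" where
  "exec zero one (MoveRight i l') \<kappa> \<kappa>' \<longleftrightarrow> \<kappa>' = goto l' (move i 1 \<kappa>)"
| "exec zero one (MoveLeft i l') \<kappa> \<kappa>' \<longleftrightarrow> \<kappa>' = goto l' (move i (- 1) \<kappa>)"
| "exec zero one (Write i a l') \<kappa> \<kappa>' \<longleftrightarrow> \<kappa>' = goto l' (put i a \<kappa>)"
| "exec zero one (IfSymbol i a l' l'') \<kappa> \<kappa>' \<longleftrightarrow>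
    \<kappa>' = goto (if scan \<kappa> i = a then l' else l'') \<kappa>"
| "exec zero one (Assign i f js l') \<kappa> \<kappa>' \<longleftrightarrow>
    (\<exists>x\<in>f (map (scan \<kappa>) js). \<kappa>' = goto l' (put i x \<kappa>))"
| "exec zero one (Branch f js l' l'') \<kappa> \<kappa>' \<longleftrightarrow>
    (f (map (scan \<kappa>) js) = {[zero]} \<and> \<kappa>' = goto l' \<kappa>) \<or>
    (f (map (scan \<kappa>) js) = {[one]} \<and> \<kappa>' = goto l'' \<kappa>)"

definition step ::
  "'u \<Rightarrow> 'u \<Rightarrow> ('l, 'u) machine \<Rightarrow> ('l, 'u) config \<Rightarrow> ('l, 'u) config \<Rightarrow> bool" where
  "step zero one M \<kappa> \<kappa>' \<longleftrightarrow>
    is_config M \<kappa> \<and> is_config M \<kappa>' \<and> lab \<kappa> \<noteq> l_final M \<and> exec zero one (stm M (lab \<kappa>)) \<kappa> \<kappa>'"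

datatype 'c sequence = Finite "'c list" | Infinite "nat \<Rightarrow> 'c"

fun first :: "'c sequence \<Rightarrow> 'c" where
  "first (Finite ks) = hd ks"
| "first (Infinite k) = k 0"

fun computation ::
  "'u \<Rightarrow> 'u \<Rightarrow> ('l, 'u) machine \<Rightarrow> ('l, 'u) config sequence \<Rightarrow> bool" where
  "computation zero one M (Finite ks) \<longleftrightarrow>
    ks \<noteq> [] \<and> (\<forall>\<kappa>\<in>set ks. is_config M \<kappa>) \<and>
    (\<forall>n. Suc n < length ks \<longrightarrow> step zero one M (ks ! n) (ks ! Suc n))"
| "computation zero one M (Infinite k) \<longleftrightarrow>
    (\<forall>n. is_config M (k n)) \<and> (\<forall>n. step zero one M (k n) (k (Suc n)))"

fun maximal_computation ::
  "'u \<Rightarrow> 'u \<Rightarrow> ('l, 'u) machine \<Rightarrow> ('l, 'u) config sequence \<Rightarrow> bool" where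
  "maximal_computation zero one M (Finite ks) \<longleftrightarrow>
    computation zero one M (Finite ks) \<and> \<not> (\<exists>\<kappa>'. step zero one M (last ks) \<kappa>')"
| "maximal_computation zero one M (Infinite k) \<longleftrightarrow> computation zero one M (Infinite k)"

definition accepting :: "('l, 'u) machine \<Rightarrow> ('l, 'u) config \<Rightarrow> bool" where
  "accepting M \<kappa> \<longleftrightarrow> is_config M \<kappa> \<and> lab \<kappa> = l_final M \<and> insc \<kappa> 0 0 \<in> data M 0"

fun accepting_computation ::
  "'u \<Rightarrow> 'u \<Rightarrow> ('l, 'u) machine \<Rightarrow> ('l, 'u) config sequence \<Rightarrow> bool" where
  "accepting_computation zero one M (Finite ks) \<longleftrightarrow>
    computation zero one M (Finite ks) \<and> accepting M (last ks)"
| "accepting_computation zero one M (Infinite k) \<longleftrightarrow> False"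

text \<open>Lists are indexed from 0, input tapes from 1.\<close>

definition initial :: "('l, 'u) machine \<Rightarrow> 'u list \<Rightarrow> ('l, 'u) config" where
  "initial M xs =
    \<lparr>lab = l_init M,
     insc = (\<lambda>i z. if 1 \<le> i \<and> i \<le> inputs M \<and> z = 0 then xs ! (i - 1) else blank M),
     head = (\<lambda>i. 0)\<rparr>"

definition computed :: "'u \<Rightarrow> 'u \<Rightarrow> ('l, 'u) machine \<Rightarrow> 'u list \<Rightarrow> 'u set" where
  "computed zero one M xs =
    {x0. xs \<in> data_prod M [1..<Suc (inputs M)] \<and>
      (\<forall>c. maximal_computation zero one M c \<and> first c = initial M xs \<longrightarrow>
        accepting_computation zero one M c) \<and>
      (\<exists>ks. accepting_computation zero one M (Finite ks) \<and> hd ks = initial M xs \<and>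
        insc (last ks) 0 0 = x0)}"

lemma multifun_computed:
  "multifun (data_prod M [1..<Suc (inputs M)]) (data M 0) (computed zero one M)"
  by (auto simp: multifun_def computed_def accepting_def)


fun stmt_realizes ::
  "'u set \<Rightarrow> (nat \<Rightarrow> 'u \<Rightarrow> 'u set) \<Rightarrow> ('l, 'u) machine \<Rightarrow>
    ('l, 'u) stmt \<Rightarrow> ('l, 'u) stmt \<Rightarrow> bool" where
  "stmt_realizes \<Sigma> \<gamma> N (Assign i f js l') t \<longleftrightarrow>
    (\<exists>g. t = Assign i g js l' \<and> multifun (data_prod N js) (data N i) g \<and>
      realizes (map \<gamma> js) (\<gamma> i) f g)"
| "stmt_realizes \<Sigma> \<gamma> N (Branch f js l' l'') t \<longleftrightarrow>
    (\<exists>g. t = Branch g js l' l'' \<and> partial_fun (data_prod N js) (lists \<Sigma>) g \<and>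
      realizes (map \<gamma> js) (id_words \<Sigma>) f g)"
| "stmt_realizes \<Sigma> \<gamma> N s t \<longleftrightarrow> t = s"

definition machine_realizes ::
  "'u set \<Rightarrow> (nat \<Rightarrow> 'u \<Rightarrow> 'u set) \<Rightarrow> ('l, 'u) machine \<Rightarrow> ('l, 'u) machine \<Rightarrow> bool" where
  "machine_realizes \<Sigma> \<gamma> M N \<longleftrightarrow>
    (\<forall>l\<in>labels M - {l_final M}. stmt_realizes \<Sigma> \<gamma> N (stm M l) (stm N l))"

end

theory Submission
  imports Defs
begin

text \<open>
  Relate a configuration of \<open>M\<close> to one of \<open>N\<close> if labels and head positions agree and
  corresponding cells hold either the same symbol of \<open>\<Gamma>\<close> or a name \<open>x\<close> of a datum \<open>y \<in> \<gamma>\<^sub>i x\<close>.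
  The data sets are disjoint from \<open>\<Gamma>\<close>, so tests for a symbol have the same outcome in related
  configurations.  Both machines may be nondeterministic and may get stuck, and the two directions
  of the argument are intertwined: once the configuration of \<open>N\<close> has a successor, the arguments of
  the function that \<open>N\<close> evaluates lie in its domain, so the realization property gives the
  configuration of \<open>M\<close> a successor as well, and every successor in \<open>M\<close> is then related to some
  successor in \<open>N\<close> (lemma \<open>simulation\<close>).  If \<open>N\<close> applies a function outside its domain, nothing
  is known about what \<open>M\<close> does; this is why the definition of \<open>f\<^sub>N\<close> demands that all maximal
  computations accept.

  That demand is a statement about finite and infinite sequences.  It is equivalent to the
  well-founded predicate \<open>surely_accepts\<close> (lemma \<open>surely_accepts_iff\<close>), and induction over this
  predicate for \<open>N\<close> makes infinite computations disappear from the proof: \<open>M\<close> surely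
  accepts, hence has a result at all, and each accepting configuration that \<open>M\<close> reaches is related
  to an accepting configuration that \<open>N\<close> reaches (lemma \<open>acceptance_transfers\<close>).  Reading off cell
  0 of tape 0 gives the theorem.
\<close>

section \<open>Finite products\<close>

lemma listset_iff_nth:
  "xs \<in> listset As \<longleftrightarrow> length xs = length As \<and> (\<forall>n<length As. xs ! n \<in> As ! n)"
proof (induction As arbitrary: xs)
  case (Cons A As)
  show ?case
    by (cases xs) (auto simp: set_Cons_def Cons.IH nth_Cons split: nat.splits)
qed simp

lemma map_in_listset_map:
  "map h js \<in> listset (map A js) \<longleftrightarrow> (\<forall>j\<in>set js. h j \<in> A j)"
  by (auto simp: listset_iff_nth all_set_conv_all_nth)

lemma in_prod_rep_iff_nth:
  "ys \<in> prod_rep \<gamma>s xs \<longleftrightarrow>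
    length xs = length \<gamma>s \<and> length ys = length \<gamma>s \<and> (\<forall>n<length \<gamma>s. ys ! n \<in> (\<gamma>s ! n) (xs ! n))"
  by (auto simp: prod_rep_def listset_iff_nth)

lemma map_in_prod_rep_map:
  "map h js \<in> prod_rep (map \<gamma> js) (map h' js) \<longleftrightarrow> (\<forall>j\<in>set js. h j \<in> \<gamma> j (h' j))"
  by (auto simp: in_prod_rep_iff_nth all_set_conv_all_nth)


section \<open>Acceptance without sequences\<close>

lemma computation_Cons:
  "computation zero one M (Finite (\<kappa> # \<kappa>' # ks)) \<longleftrightarrow>
    step zero one M \<kappa> \<kappa>' \<and> computation zero one M (Finite (\<kappa>' # ks))"
proof -
  have "(\<forall>n. Suc n < length (\<kappa> # \<kappa>' # ks) \<longrightarrow>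
          step zero one M ((\<kappa> # \<kappa>' # ks) ! n) ((\<kappa> # \<kappa>' # ks) ! Suc n)) \<longleftrightarrow>
        step zero one M \<kappa> \<kappa>' \<and>
        (\<forall>n. Suc n < length (\<kappa>' # ks) \<longrightarrow>
          step zero one M ((\<kappa>' # ks) ! n) ((\<kappa>' # ks) ! Suc n))"
    (is "(\<forall>n. ?P n) \<longleftrightarrow> ?S \<and> (\<forall>n. ?Q n)")
  proof -
    have "(\<forall>n. ?P n) \<longleftrightarrow> ?P 0 \<and> (\<forall>n. ?P (Suc n))"
      by (metis not0_implies_Suc)
    then show ?thesis by simp
  qed
  moreover have "step zero one M \<kappa> \<kappa>' \<Longrightarrow> is_config M \<kappa>"
    by (simp add: step_def)
  ultimately show ?thesis
    unfolding computation.simps by auto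
qed

lemma finite_computation_iff_steps:
  "(\<exists>ks. computation zero one M (Finite ks) \<and> hd ks = \<kappa> \<and> last ks = \<kappa>') \<longleftrightarrow>
    is_config M \<kappa> \<and> (step zero one M)\<^sup>*\<^sup>* \<kappa> \<kappa>'"
proof
  have "is_config M (hd ks) \<and> (step zero one M)\<^sup>*\<^sup>* (hd ks) (last ks)"
    if "computation zero one M (Finite ks)" for ks
    using that
  proof (induction ks rule: induct_list012)
    case (3 \<kappa>1 \<kappa>2 ks)
    then have s: "step zero one M \<kappa>1 \<kappa>2" and c: "computation zero one M (Finite (\<kappa>2 # ks))"
      by (simp_all only: computation_Cons)
    show ?case
      using s "3.IH"(2)[OF c] by (auto simp: step_def intro: converse_rtranclp_into_rtranclp)
  qed auto
  then show "\<exists>ks. computation zero one M (Finite ks) \<and> hd ks = \<kappa> \<and> last ks = \<kappa>' \<Longrightarrow>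
      is_config M \<kappa> \<and> (step zero one M)\<^sup>*\<^sup>* \<kappa> \<kappa>'"
    by blast
next
  assume "is_config M \<kappa> \<and> (step zero one M)\<^sup>*\<^sup>* \<kappa> \<kappa>'"
  then have "(step zero one M)\<^sup>*\<^sup>* \<kappa> \<kappa>'" and "is_config M \<kappa>" by auto
  then show "\<exists>ks. computation zero one M (Finite ks) \<and> hd ks = \<kappa> \<and> last ks = \<kappa>'"
  proof (induction rule: converse_rtranclp_induct)
    case base
    then show ?case by (intro exI[of _ "[\<kappa>']"]) simp
  next
    case (step \<kappa>1 \<kappa>2)
    then obtain ks where ks: "computation zero one M (Finite ks)" "hd ks = \<kappa>2" "last ks = \<kappa>'"
      by (auto simp: step_def)
    then obtain ks' where "ks = \<kappa>2 # ks'" by (cases ks) auto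
    with ks step.hyps show ?case
      by (intro exI[of _ "\<kappa>1 # ks"]) (simp add: computation_Cons del: computation.simps)
  qed
qed

lemma accepting_no_step: "accepting M \<kappa> \<Longrightarrow> \<not> step zero one M \<kappa> \<kappa>'"
  by (simp add: accepting_def step_def)

text \<open>
  Being a least fixed point, this predicate excludes infinite computations; its rule excludes
  computations that get stuck in a configuration that is not accepting.
\<close>

inductive surely_accepts :: "'u \<Rightarrow> 'u \<Rightarrow> ('l, 'u) machine \<Rightarrow> ('l, 'u) config \<Rightarrow> bool"
  for zero one M where
  surely_acceptsI:
    "(\<And>\<kappa>'. step zero one M \<kappa> \<kappa>' \<Longrightarrow> surely_accepts zero one M \<kappa>') \<Longrightarrow>
     accepting M \<kappa> \<or> (\<exists>\<kappa>'. step zero one M \<kappa> \<kappa>') \<Longrightarrow>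
     surely_accepts zero one M \<kappa>"

lemma surely_accepts_maximal_computation:
  assumes "surely_accepts zero one M \<kappa>"
    and "maximal_computation zero one M c" and "first c = \<kappa>"
  shows "accepting_computation zero one M c"
  using assms
proof (induction arbitrary: c rule: surely_accepts.induct)
  case (surely_acceptsI \<kappa>)
  show ?case
  proof (cases c)
    case (Infinite k)
    \<comment> \<open>The tail of an infinite computation is again maximal, so it would have to be finite.\<close>
    have "step zero one M \<kappa> (k 1)" and "maximal_computation zero one M (Infinite (\<lambda>n. k (Suc n)))"
      using surely_acceptsI.prems Infinite by auto
    from surely_acceptsI.IH[OF this] show ?thesis by simp
  next
    case (Finite ks)
    with surely_acceptsI.prems have comp: "computation zero one M (Finite ks)"
      and stuck: "\<not> (\<exists>\<kappa>'. step zero one M (last ks) \<kappa>')" and "hd ks = \<kappa>" by auto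
    then obtain ks' where ks: "ks = \<kappa> # ks'" by (cases ks) auto
    show ?thesis
    proof (cases ks')
      case Nil
      with ks comp stuck surely_acceptsI.hyps Finite show ?thesis by auto
    next
      case (Cons \<kappa>' ks'')
      with ks comp have s: "step zero one M \<kappa> \<kappa>'"
        and tail: "computation zero one M (Finite (\<kappa>' # ks''))"
        by (simp_all only: computation_Cons)
      have "accepting_computation zero one M (Finite (\<kappa>' # ks''))"
        using surely_acceptsI.IH[OF s, of "Finite (\<kappa>' # ks'')"] tail stuck ks Cons by simp
      with comp ks Cons Finite show ?thesis by simp
    qed
  qed
qed

lemma not_surely_accepts_maximal_computation:
  assumes "\<not> surely_accepts zero one M \<kappa>" and conf: "is_config M \<kappa>"
  obtains c where "maximal_computation zero one M c" "first c = \<kappa>"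
    "\<not> accepting_computation zero one M c"
proof (cases "\<exists>\<kappa>'. (step zero one M)\<^sup>*\<^sup>* \<kappa> \<kappa>' \<and> \<not> accepting M \<kappa>' \<and> \<not> (\<exists>\<kappa>''. step zero one M \<kappa>' \<kappa>'')")
  case True
  then obtain \<kappa>' where \<kappa>': "(step zero one M)\<^sup>*\<^sup>* \<kappa> \<kappa>'" "\<not> accepting M \<kappa>'"
    "\<not> (\<exists>\<kappa>''. step zero one M \<kappa>' \<kappa>'')" by blast
  with conf obtain ks where "computation zero one M (Finite ks)" "hd ks = \<kappa>" "last ks = \<kappa>'"
    using finite_computation_iff_steps[of zero one M \<kappa> \<kappa>'] by blast
  with \<kappa>' that[of "Finite ks"] show ?thesis by auto
next
  case False
  \<comment> \<open>No reachable dead end is to blame, so failure can be passed on to a successor forever.\<close>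
  let ?bad = "\<lambda>\<kappa>'. (step zero one M)\<^sup>*\<^sup>* \<kappa> \<kappa>' \<and> \<not> surely_accepts zero one M \<kappa>'"
  have "\<exists>\<kappa>2. ?bad \<kappa>2 \<and> step zero one M \<kappa>1 \<kappa>2" if bad: "?bad \<kappa>1" for \<kappa>1
  proof -
    have "accepting M \<kappa>1 \<or> (\<exists>\<kappa>2. step zero one M \<kappa>1 \<kappa>2)"
      using bad False by blast
    with bad obtain \<kappa>2 where "step zero one M \<kappa>1 \<kappa>2" "\<not> surely_accepts zero one M \<kappa>2"
      using surely_acceptsI[of zero one M \<kappa>1] by blast
    with bad show ?thesis by (meson rtranclp.rtrancl_into_rtrancl)
  qed
  with assms(1) have "\<exists>k. \<forall>n. (?bad (k n) \<and> (n = 0 \<longrightarrow> k n = \<kappa>)) \<and> step zero one M (k n) (k (Suc n))"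
    by (intro dependent_nat_choice) auto
  then obtain k where "\<And>n. step zero one M (k n) (k (Suc n))" and "k 0 = \<kappa>"
    by blast
  then have "maximal_computation zero one M (Infinite k)"
    by (auto simp: step_def)
  with \<open>k 0 = \<kappa>\<close> that[of "Infinite k"] show ?thesis by simp
qed

lemma surely_accepts_iff:
  assumes "is_config M \<kappa>"
  shows "surely_accepts zero one M \<kappa> \<longleftrightarrow>
    (\<forall>c. maximal_computation zero one M c \<and> first c = \<kappa> \<longrightarrow> accepting_computation zero one M c)"
  using surely_accepts_maximal_computation not_surely_accepts_maximal_computation[OF _ assms]
  by metis

lemma surely_accepts_reaches_accepting:
  assumes "surely_accepts zero one M \<kappa>"
  obtains \<kappa>' where "(step zero one M)\<^sup>*\<^sup>* \<kappa> \<kappa>'" "accepting M \<kappa>'"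
proof -
  from assms have "\<exists>\<kappa>'. (step zero one M)\<^sup>*\<^sup>* \<kappa> \<kappa>' \<and> accepting M \<kappa>'"
    by (induction rule: surely_accepts.induct) (meson converse_rtranclp_into_rtranclp rtranclp.rtrancl_refl)
  with that show ?thesis by blast
qed

lemma is_config_initial:
  assumes "gtm \<Sigma> zero one M" and "xs \<in> data_prod M [1..<Suc (inputs M)]"
  shows "is_config M (initial M xs)"
proof -
  have "xs ! n \<in> data M (Suc n)" if "n < inputs M" for n
    using assms(2) that by (auto simp: data_prod_def listset_iff_nth simp del: upt_Suc)
  then have "xs ! (i - 1) \<in> data M i" if "1 \<le> i" "i \<le> inputs M" for i
    using that by (cases i) auto
  with assms(1) show ?thesis
    by (auto simp: is_config_def initial_def gtm_def)
qed

lemma in_computed_iff: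
  assumes "gtm \<Sigma> zero one M"
  shows "x0 \<in> computed zero one M xs \<longleftrightarrow>
    xs \<in> data_prod M [1..<Suc (inputs M)] \<and> surely_accepts zero one M (initial M xs) \<and>
    (\<exists>\<kappa>. (step zero one M)\<^sup>*\<^sup>* (initial M xs) \<kappa> \<and> accepting M \<kappa> \<and> insc \<kappa> 0 0 = x0)"
proof (cases "xs \<in> data_prod M [1..<Suc (inputs M)]")
  case True
  note conf = is_config_initial[OF assms True]
  have "(\<exists>ks. accepting_computation zero one M (Finite ks) \<and> hd ks = initial M xs \<and>
          insc (last ks) 0 0 = x0) \<longleftrightarrow>
        (\<exists>\<kappa>. (\<exists>ks. computation zero one M (Finite ks) \<and> hd ks = initial M xs \<and> last ks = \<kappa>) \<and>
          accepting M \<kappa> \<and> insc \<kappa> 0 0 = x0)"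
    unfolding accepting_computation.simps by blast
  with True conf show ?thesis
    unfolding computed_def finite_computation_iff_steps surely_accepts_iff[OF conf] by auto
qed (simp add: computed_def)


section \<open>Simulation\<close>

locale machine_realization =
  fixes \<Sigma> :: "'u set" and zero one :: 'u
    and M N :: "('l, 'u) machine"
    and \<gamma> :: "nat \<Rightarrow> 'u \<Rightarrow> 'u set"
  assumes gtm_M: "gtm \<Sigma> zero one M"
    and gtm_N: "gtm \<Sigma> zero one N"
    and same: "labels N = labels M" "l_init N = l_init M" "l_final N = l_final M"
      "gamma N = gamma M" "blank N = blank M" "inputs N = inputs M" "last_tape N = last_tape M"
    and multirep: "\<forall>i\<le>last_tape M. gen_multirep (data M i) (data N i) (\<gamma> i)"
    and realizing: "machine_realizes \<Sigma> \<gamma> M N"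
begin

definition cell_rel :: "nat \<Rightarrow> 'u \<Rightarrow> 'u \<Rightarrow> bool" where
  "cell_rel i x y \<longleftrightarrow> y \<in> \<gamma> i x \<or> x = y \<and> x \<in> gamma M"

text \<open>
  Membership of the label in the common label set is included so that related configurations are
  configurations of their machines.
\<close>

definition config_rel :: "('l, 'u) config \<Rightarrow> ('l, 'u) config \<Rightarrow> bool" where
  "config_rel \<kappa> \<nu> \<longleftrightarrow> lab \<kappa> = lab \<nu> \<and> lab \<kappa> \<in> labels M \<and> head \<kappa> = head \<nu> \<and>
    (\<forall>i\<le>last_tape M. \<forall>z. cell_rel i (insc \<kappa> i z) (insc \<nu> i z))"

lemma \<gamma>_data:
  assumes "i \<le> last_tape M" "y \<in> \<gamma> i x"
  shows "x \<in> data M i" "y \<in> data N i"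
  using assms multirep by (auto simp: gen_multirep_def multifun_def)

lemma data_disjoint_gamma:
  assumes "i \<le> last_tape M"
  shows "data M i \<inter> gamma M = {}" "data N i \<inter> gamma M = {}"
  using assms gtm_M gtm_N same by (auto simp: gtm_def)

lemma cell_rel_data:
  assumes "i \<le> last_tape M" "cell_rel i x y"
  shows "x \<in> data M i \<union> gamma M" "y \<in> data N i \<union> gamma M"
    "x \<in> data M i \<longleftrightarrow> y \<in> data N i" "x \<in> data M i \<Longrightarrow> y \<in> \<gamma> i x"
  using assms \<gamma>_data[of i] data_disjoint_gamma[of i] by (auto simp: cell_rel_def)

lemma cell_rel_symbol:
  assumes "i \<le> last_tape M" "cell_rel i x y" "a \<in> gamma M"
  shows "x = a \<longleftrightarrow> y = a"
  using assms \<gamma>_data[of i y x] data_disjoint_gamma[of i] by (auto simp: cell_rel_def)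

lemma config_rel_is_config:
  assumes "config_rel \<kappa> \<nu>"
  shows "is_config M \<kappa>" "is_config N \<nu>"
  using assms cell_rel_data(1,2) unfolding config_rel_def is_config_def same by metis+

lemma config_rel_scan:
  assumes "config_rel \<kappa> \<nu>" "i \<le> last_tape M"
  shows "cell_rel i (scan \<kappa> i) (scan \<nu> i)"
  using assms by (simp add: config_rel_def scan_def)

lemma config_rel_goto:
  assumes "config_rel \<kappa> \<nu>" "l \<in> labels M"
  shows "config_rel (goto l \<kappa>) (goto l \<nu>)"
  using assms by (auto simp: config_rel_def goto_def)

lemma config_rel_move:
  assumes "config_rel \<kappa> \<nu>"
  shows "config_rel (move i d \<kappa>) (move i d \<nu>)"
  using assms by (auto simp: config_rel_def move_def)

lemma config_rel_put:
  assumes "config_rel \<kappa> \<nu>" "cell_rel i x y"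
  shows "config_rel (put i x \<kappa>) (put i y \<nu>)"
  using assms by (auto simp: config_rel_def put_def)

text \<open>
  A nonempty value of \<open>g\<close> forces the scanned cells of \<open>N\<close> to contain data rather than symbols of
  \<open>\<Gamma>\<close>.  Hence the scanned cells of \<open>M\<close> hold names of these data, which is what the realization
  property asks for.
\<close>

lemma realizes_scanned:
  assumes rel: "config_rel \<kappa> \<nu>" and js: "set js \<subseteq> {..last_tape M}"
    and g: "multifun (data_prod N js) B g" and real: "realizes (map \<gamma> js) \<delta> f g"
    and nonempty: "g (map (scan \<nu>) js) \<noteq> {}"
  shows "f (map (scan \<kappa>) js) \<noteq> {}"
    and "\<And>v. v \<in> f (map (scan \<kappa>) js) \<Longrightarrow> g (map (scan \<nu>) js) \<inter> \<delta> v \<noteq> {}"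
proof -
  from g nonempty have "map (scan \<nu>) js \<in> data_prod N js"
    by (auto simp: multifun_def)
  then have "\<forall>j\<in>set js. scan \<nu> j \<in> data N j"
    by (simp add: data_prod_def map_in_listset_map)
  with js have "\<forall>j\<in>set js. scan \<nu> j \<in> \<gamma> j (scan \<kappa> j)"
    using cell_rel_data(3,4)[OF _ config_rel_scan[OF rel]] by (meson atMost_iff subsetD)
  then have "map (scan \<nu>) js \<in> prod_rep (map \<gamma> js) (map (scan \<kappa>) js) \<inter> mdom g"
    using nonempty by (simp add: map_in_prod_rep_map mdom_def)
  with real show "f (map (scan \<kappa>) js) \<noteq> {}"
    and "\<And>v. v \<in> f (map (scan \<kappa>) js) \<Longrightarrow> g (map (scan \<nu>) js) \<inter> \<delta> v \<noteq> {}"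
    unfolding realizes_def by blast+
qed

lemma simulation_exec:
  assumes rel: "config_rel \<kappa> \<nu>" and wf: "wf_stmt \<Sigma> zero one M s"
    and real: "stmt_realizes \<Sigma> \<gamma> N s t" and ex: "exec zero one t \<nu> \<nu>1"
  shows "(\<exists>\<kappa>1. exec zero one s \<kappa> \<kappa>1) \<and>
    (\<forall>\<kappa>1. exec zero one s \<kappa> \<kappa>1 \<longrightarrow> (\<exists>\<nu>2. exec zero one t \<nu> \<nu>2 \<and> config_rel \<kappa>1 \<nu>2))"
proof (cases s)
  case (MoveRight i l)
  with rel wf real show ?thesis by (auto intro!: config_rel_goto config_rel_move)
next
  case (MoveLeft i l)
  with rel wf real show ?thesis by (auto intro!: config_rel_goto config_rel_move)
next
  case (Write i a l)
  with rel wf real show ?thesis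
    by (auto intro!: config_rel_goto config_rel_put simp: cell_rel_def)
next
  case (IfSymbol i a l l')
  with wf have "scan \<kappa> i = a \<longleftrightarrow> scan \<nu> i = a"
    using cell_rel_symbol[OF _ config_rel_scan[OF rel]] by simp
  with IfSymbol rel wf real show ?thesis by (auto intro!: config_rel_goto)
next
  case (Assign i f js l)
  with real obtain g where t: "t = Assign i g js l" and g: "multifun (data_prod N js) (data N i) g"
    and real': "realizes (map \<gamma> js) (\<gamma> i) f g" by auto
  from Assign wf have js: "set js \<subseteq> {..last_tape M}" and l: "l \<in> labels M" by auto
  from ex t have "g (map (scan \<nu>) js) \<noteq> {}" by auto
  then have f: "f (map (scan \<kappa>) js) \<noteq> {}"
    "\<And>x. x \<in> f (map (scan \<kappa>) js) \<Longrightarrow> g (map (scan \<nu>) js) \<inter> \<gamma> i x \<noteq> {}"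
    using realizes_scanned[OF rel js g real'] by blast+
  have "\<exists>\<nu>2. exec zero one t \<nu> \<nu>2 \<and> config_rel (goto l (put i x \<kappa>)) \<nu>2"
    if "x \<in> f (map (scan \<kappa>) js)" for x
  proof -
    from f(2)[OF that] obtain y where "y \<in> g (map (scan \<nu>) js)" "y \<in> \<gamma> i x" by blast
    with t l rel show ?thesis
      by (auto simp: cell_rel_def intro!: exI[of _ "goto l (put i y \<nu>)"] config_rel_goto config_rel_put)
  qed
  with f(1) Assign show ?thesis by auto
next
  case (Branch f js l l')
  with real obtain g where t: "t = Branch g js l l'" and g: "multifun (data_prod N js) (lists \<Sigma>) g"
    and real': "realizes (map \<gamma> js) (id_words \<Sigma>) f g" by (auto simp: partial_fun_def)
  from Branch wf have js: "set js \<subseteq> {..last_tape M}" and l: "l \<in> labels M" "l' \<in> labels M" by auto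
  from ex t have bit: "g (map (scan \<nu>) js) = {[zero]} \<or> g (map (scan \<nu>) js) = {[one]}" by auto
  then have "g (map (scan \<nu>) js) \<noteq> {}" by auto
  from realizes_scanned[OF rel js g real' this]
  have f: "f (map (scan \<kappa>) js) \<noteq> {}"
    "\<And>w. w \<in> f (map (scan \<kappa>) js) \<Longrightarrow> g (map (scan \<nu>) js) \<inter> id_words \<Sigma> w \<noteq> {}"
    by blast+
  have "f (map (scan \<kappa>) js) \<subseteq> g (map (scan \<nu>) js)"
  proof
    show "w \<in> g (map (scan \<nu>) js)" if "w \<in> f (map (scan \<kappa>) js)" for w
      using f(2)[OF that] by (auto simp: id_words_def split: if_splits)
  qed
  \<comment> \<open>A nonempty subset of a singleton is that singleton.\<close>
  with bit f(1) have "f (map (scan \<kappa>) js) = g (map (scan \<nu>) js)"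
    by (metis subset_singletonD)
  with bit Branch t l rel show ?thesis by (auto intro!: config_rel_goto)
qed

lemma simulation:
  assumes rel: "config_rel \<kappa> \<nu>" and step: "step zero one N \<nu> \<nu>1"
  shows "\<exists>\<kappa>1. step zero one M \<kappa> \<kappa>1"
    and "\<And>\<kappa>1. step zero one M \<kappa> \<kappa>1 \<Longrightarrow> \<exists>\<nu>2. step zero one N \<nu> \<nu>2 \<and> config_rel \<kappa>1 \<nu>2"
proof -
  have lab: "lab \<nu> = lab \<kappa>" "lab \<kappa> \<in> labels M - {l_final M}"
    using rel step by (auto simp: config_rel_def step_def same)
  then have "wf_stmt \<Sigma> zero one M (stm M (lab \<kappa>))"
    and "stmt_realizes \<Sigma> \<gamma> N (stm M (lab \<kappa>)) (stm N (lab \<kappa>))"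
    using gtm_M realizing by (auto simp: gtm_def machine_realizes_def)
  moreover have "exec zero one (stm N (lab \<kappa>)) \<nu> \<nu>1"
    using step lab by (simp add: step_def)
  ultimately have sim: "\<exists>\<kappa>1. exec zero one (stm M (lab \<kappa>)) \<kappa> \<kappa>1"
    "\<And>\<kappa>1. exec zero one (stm M (lab \<kappa>)) \<kappa> \<kappa>1 \<Longrightarrow>
      \<exists>\<nu>2. exec zero one (stm N (lab \<kappa>)) \<nu> \<nu>2 \<and> config_rel \<kappa>1 \<nu>2"
    using simulation_exec[OF rel] by blast+
  show "\<exists>\<kappa>1. step zero one M \<kappa> \<kappa>1"
    using sim lab config_rel_is_config(1) rel unfolding step_def by blast
  show "\<exists>\<nu>2. step zero one N \<nu> \<nu>2 \<and> config_rel \<kappa>1 \<nu>2" if "step zero one M \<kappa> \<kappa>1" for \<kappa>1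
    using that sim(2) lab config_rel_is_config(2) rel same(3) unfolding step_def by fastforce
qed

lemma config_rel_accepting:
  assumes "config_rel \<kappa> \<nu>"
  shows "accepting M \<kappa> \<longleftrightarrow> accepting N \<nu>"
proof -
  have "cell_rel 0 (insc \<kappa> 0 0) (insc \<nu> 0 0)"
    using assms by (simp add: config_rel_def)
  then have "insc \<kappa> 0 0 \<in> data M 0 \<longleftrightarrow> insc \<nu> 0 0 \<in> data N 0"
    using cell_rel_data(3)[of 0] by blast
  with assms config_rel_is_config[OF assms] show ?thesis
    by (simp add: accepting_def config_rel_def same)
qed

text \<open>
  The hypothesis on \<open>N\<close> provides the successor that \<open>simulation\<close> needs wherever \<open>N\<close> has not
  accepted yet.  The second conclusion lets every run of \<open>M\<close> select a run of \<open>N\<close>, so an outcome of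
  \<open>M\<close> names some outcome of \<open>N\<close>.
\<close>

lemma acceptance_transfers:
  assumes "surely_accepts zero one N \<nu>" and "config_rel \<kappa> \<nu>"
  shows "surely_accepts zero one M \<kappa>"
    and "\<And>\<kappa>'. (step zero one M)\<^sup>*\<^sup>* \<kappa> \<kappa>' \<Longrightarrow> accepting M \<kappa>' \<Longrightarrow>
      \<exists>\<nu>'. (step zero one N)\<^sup>*\<^sup>* \<nu> \<nu>' \<and> accepting N \<nu>' \<and> config_rel \<kappa>' \<nu>'"
proof -
  from assms have "surely_accepts zero one M \<kappa> \<and>
    (\<forall>\<kappa>'. (step zero one M)\<^sup>*\<^sup>* \<kappa> \<kappa>' \<and> accepting M \<kappa>' \<longrightarrow>
      (\<exists>\<nu>'. (step zero one N)\<^sup>*\<^sup>* \<nu> \<nu>' \<and> accepting N \<nu>' \<and> config_rel \<kappa>' \<nu>'))"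
  proof (induction arbitrary: \<kappa> rule: surely_accepts.induct)
    case (surely_acceptsI \<nu>)
    note rel = surely_acceptsI.prems
    from surely_acceptsI.hyps(2) show ?case
    proof
      assume acc: "accepting N \<nu>"
      with rel have "accepting M \<kappa>" by (simp add: config_rel_accepting)
      then have stuck: "\<not> step zero one M \<kappa> \<kappa>1" for \<kappa>1
        by (rule accepting_no_step)
      with \<open>accepting M \<kappa>\<close> have "surely_accepts zero one M \<kappa>"
        by (auto intro: surely_accepts.intros[where \<kappa> = \<kappa>])
      moreover have "\<exists>\<nu>'. (step zero one N)\<^sup>*\<^sup>* \<nu> \<nu>' \<and> accepting N \<nu>' \<and> config_rel \<kappa>' \<nu>'"
        if "(step zero one M)\<^sup>*\<^sup>* \<kappa> \<kappa>'" for \<kappa>'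
      proof -
        from that have "\<kappa>' = \<kappa>"
          using stuck by (cases rule: converse_rtranclpE) auto
        then show ?thesis
          using acc rel by blast
      qed
      ultimately show ?thesis by (intro conjI allI impI) auto
    next
      assume "\<exists>\<nu>1. step zero one N \<nu> \<nu>1"
      then obtain \<nu>1 where "step zero one N \<nu> \<nu>1" ..
      note sim = simulation[OF rel this]
      have nonacc: "\<not> accepting M \<kappa>"
        using sim(1) by (auto dest: accepting_no_step)
      have "surely_accepts zero one M \<kappa>"
      proof (rule surely_accepts.intros)
        show "surely_accepts zero one M \<kappa>1" if "step zero one M \<kappa> \<kappa>1" for \<kappa>1
          using sim(2)[OF that] surely_acceptsI.IH by blast
      qed (use sim(1) in blast)
      moreover have "\<exists>\<nu>'. (step zero one N)\<^sup>*\<^sup>* \<nu> \<nu>' \<and> accepting N \<nu>' \<and> config_rel \<kappa>' \<nu>'"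
        if reach: "(step zero one M)\<^sup>*\<^sup>* \<kappa> \<kappa>'" and acc: "accepting M \<kappa>'" for \<kappa>'
      proof -
        from reach nonacc acc obtain \<kappa>1 where "step zero one M \<kappa> \<kappa>1" "(step zero one M)\<^sup>*\<^sup>* \<kappa>1 \<kappa>'"
          by (metis converse_rtranclpE)
        moreover from this(1) sim(2) obtain \<nu>2 where "step zero one N \<nu> \<nu>2" "config_rel \<kappa>1 \<nu>2"
          by blast
        ultimately show ?thesis
          using surely_acceptsI.IH acc by (meson converse_rtranclp_into_rtranclp)
      qed
      ultimately show ?thesis by blast
    qed
  qed
  then show "surely_accepts zero one M \<kappa>"
    and "\<And>\<kappa>'. (step zero one M)\<^sup>*\<^sup>* \<kappa> \<kappa>' \<Longrightarrow> accepting M \<kappa>' \<Longrightarrow>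
      \<exists>\<nu>'. (step zero one N)\<^sup>*\<^sup>* \<nu> \<nu>' \<and> accepting N \<nu>' \<and> config_rel \<kappa>' \<nu>'"
    by blast+
qed

lemma inputs_related:
  assumes "ys \<in> prod_rep (map \<gamma> [1..<Suc (inputs M)]) xs"
  shows "xs \<in> data_prod M [1..<Suc (inputs M)]" and "config_rel (initial M xs) (initial N ys)"
proof -
  have len: "length xs = inputs M" and named: "\<And>n. n < inputs M \<Longrightarrow> ys ! n \<in> \<gamma> (Suc n) (xs ! n)"
    using assms by (auto simp: in_prod_rep_iff_nth simp del: upt_Suc)
  have bounds: "inputs M \<le> last_tape M" "blank M \<in> gamma M" "l_init M \<in> labels M"
    using gtm_M by (auto simp: gtm_def)
  have "xs ! n \<in> data M (Suc n)" if "n < inputs M" for n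
    using \<gamma>_data(1) named that bounds(1) by (meson Suc_leI order_trans)
  with len show "xs \<in> data_prod M [1..<Suc (inputs M)]"
    by (auto simp: data_prod_def listset_iff_nth simp del: upt_Suc)
  have "ys ! (i - 1) \<in> \<gamma> i (xs ! (i - 1))" if "1 \<le> i" "i \<le> inputs M" for i
    using named[of "i - 1"] that by simp
  with bounds show "config_rel (initial M xs) (initial N ys)"
    by (auto simp: config_rel_def initial_def cell_rel_def same)
qed

theorem computed_realizes:
  "realizes (map \<gamma> [1..<Suc (inputs M)]) (\<gamma> 0) (computed zero one M) (computed zero one N)"
  unfolding realizes_def
proof (intro allI impI conjI ballI)
  fix xs ys
  assume "ys \<in> prod_rep (map \<gamma> [1..<Suc (inputs M)]) xs \<inter> mdom (computed zero one N)"
  then have named: "ys \<in> prod_rep (map \<gamma> [1..<Suc (inputs M)]) xs"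
    and "computed zero one N ys \<noteq> {}" by (auto simp: mdom_def)
  then have ys: "ys \<in> data_prod N [1..<Suc (inputs N)]"
    and sure: "surely_accepts zero one N (initial N ys)"
    by (auto simp: in_computed_iff[OF gtm_N] simp del: upt_Suc)
  note transfer = acceptance_transfers[OF sure inputs_related(2)[OF named]]
  obtain \<kappa> where "(step zero one M)\<^sup>*\<^sup>* (initial M xs) \<kappa>" "accepting M \<kappa>"
    using surely_accepts_reaches_accepting[OF transfer(1)] .
  with transfer(1) inputs_related(1)[OF named] show "computed zero one M xs \<noteq> {}"
    by (auto simp: in_computed_iff[OF gtm_M] ex_in_conv[symmetric] simp del: upt_Suc)
  fix x0
  assume "x0 \<in> computed zero one M xs"
  then obtain \<kappa> where \<kappa>: "(step zero one M)\<^sup>*\<^sup>* (initial M xs) \<kappa>" "accepting M \<kappa>" "insc \<kappa> 0 0 = x0"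
    by (auto simp: in_computed_iff[OF gtm_M])
  from transfer(2)[OF \<kappa>(1,2)] obtain \<nu> where
    \<nu>: "(step zero one N)\<^sup>*\<^sup>* (initial N ys) \<nu>" "accepting N \<nu>" and rel: "config_rel \<kappa> \<nu>"
    by blast
  have "insc \<nu> 0 0 \<in> computed zero one N ys"
    using ys sure \<nu> by (auto simp: in_computed_iff[OF gtm_N] simp del: upt_Suc)
  moreover have "insc \<nu> 0 0 \<in> \<gamma> 0 x0"
    using cell_rel_data(4)[of 0 x0 "insc \<nu> 0 0"] rel \<kappa>(2,3)
    by (auto simp: config_rel_def accepting_def)
  ultimately show "computed zero one N ys \<inter> \<gamma> 0 x0 \<noteq> {}" by blast
qed

end

theorem theorem4p2:
  fixes \<Sigma> :: "'u set" and zero one :: 'u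
    and M N :: "('l, 'u) machine"
    and \<gamma> :: "nat \<Rightarrow> 'u \<Rightarrow> 'u set"
  assumes "alphabet \<Sigma> zero one"
    and "gtm \<Sigma> zero one M"
    and "gtm \<Sigma> zero one N"
    and "labels N = labels M" and "l_init N = l_init M" and "l_final N = l_final M"
    and "gamma N = gamma M" and "blank N = blank M"
    and "inputs N = inputs M" and "last_tape N = last_tape M"
    and "\<forall>i\<le>last_tape M. gen_multirep (data M i) (data N i) (\<gamma> i)"
    and "machine_realizes \<Sigma> \<gamma> M N"
  shows "realizes (map \<gamma> [1..<Suc (inputs M)]) (\<gamma> 0) (computed zero one M) (computed zero one N)"
proof -
  interpret machine_realization \<Sigma> zero one M N \<gamma>
    using assms by unfold_locales
  show ?thesis by (rule computed_realizes)
qed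

end
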